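(* Let $P\in\mathbb{R}^{n\times n}$ satisfy $P=P^\top$, $P_{ij}\in[0,1]$ and $P_{ii}=0$ for all $i,j\in\{1,\dots,n\}$, let $a\in\mathbb{R}\setminus\{0\}$ and $b\in\mathbb{R}^n$, and assume $\max_{i}a\,\lambda_i(P+P^\top)<1$. Consider the pseudo-gradient dynamics $$\dot x(t)=(-I+aP)x(t)+b+u(t)$$ interconnected with the adaptive feedback intervention $u(t)=K(t)x(t)$, where the matrix $K(t)\in\mathbb{R}^{n\times n}$ is determined by $$\begin{aligned} \dot z(t)&=-z(t)+K(t)x(t)+b+u(t),\\ \dot w(t)&=-w(t)+e(t)x^\top(t)x(t),\\ \dot K(t)&=e(t)x^\top(t), \end{aligned}\qquad e(t):=x(t)-z(t)-w(t),$$ with $x(t),z(t),w(t)\in\mathbb{R}^n$. Then (for every initial condition $(x(0),z(0),w(0),K(0))$) the action profile $x(t)$ converges, as $t\to\infty$, to the social optimum $x_{\mathrm{opt}}$.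
   Context: $\lambda_i(P+P^\top)$, $i=1,\dots,n$, are the eigenvalues of $P+P^\top$. In this unconstrained setting (actions take values in $\mathbb{R}$, interventions in $\mathbb{R}^n$), the social optimum $x_{\mathrm{opt}}$ is the unique maximizer over $y\in\mathbb{R}^n$ of the social welfare $\sum_{i=1}^n\big(-\tfrac12y_i^2+y_i(a\sum_{j=1}^nP_{ij}y_j+b_i)\big)$; equivalently, the unique solution of $\big(I-a(P+P^\top)\big)x_{\mathrm{opt}}=b$. *)

theory Defs
  imports "HOL-Analysis.Analysis"
begin

definition eigenvalue :: "real^'n^'n \<Rightarrow> real \<Rightarrow> bool" where
  "eigenvalue A l \<longleftrightarrow> (\<exists>v. v \<noteq> 0 \<and> A *v v = l *\<^sub>R v)"

text \<open>Only real eigenvalues are collected. For a symmetric matrix, such as \<open>P + transpose P\<close>,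
  these are all of them, so the spectrum is finite and nonempty and \<open>Max\<close> over it is meaningful.\<close>

definition spectrum :: "real^'n^'n \<Rightarrow> real set" where
  "spectrum A = {l. eigenvalue A l}"

definition social_welfare :: "real^'n^'n \<Rightarrow> real \<Rightarrow> real^'n \<Rightarrow> real^'n \<Rightarrow> real" where
  "social_welfare P a b y =
     (\<Sum>i\<in>UNIV. - (1/2) * (y$i)\<^sup>2 + y$i * (a * (\<Sum>j\<in>UNIV. P$i$j * y$j) + b$i))"

definition social_optimum :: "real^'n^'n \<Rightarrow> real \<Rightarrow> real^'n \<Rightarrow> real^'n" where
  "social_optimum P a b = (THE y. is_arg_max (social_welfare P a b) (\<lambda>_. True) y)"

definition outer_product :: "real^'n \<Rightarrow> real^'n \<Rightarrow> real^'n^'n" where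
  "outer_product v w = (\<chi> i j. v$i * w$j)"

text \<open>Trajectories of the closed loop on the whole half-line \<open>t \<ge> 0\<close>. The derivative at \<open>t = 0\<close> is
  one-sided, and values at negative times are unconstrained.\<close>

definition closed_loop_solution ::
  "real^'n^'n \<Rightarrow> real \<Rightarrow> real^'n \<Rightarrow>
   (real \<Rightarrow> real^'n) \<Rightarrow> (real \<Rightarrow> real^'n) \<Rightarrow> (real \<Rightarrow> real^'n) \<Rightarrow> (real \<Rightarrow> real^'n^'n) \<Rightarrow> bool" where
  "closed_loop_solution P a b x z w K \<longleftrightarrow>
     (\<forall>t\<ge>0.
        let u = K t *v x t; e = x t - z t - w t in
          (x has_vector_derivative ((- mat 1 + a *\<^sub>R P) *v x t + b + u)) (at t within {0..}) \<and>
          (z has_vector_derivative (- z t + K t *v x t + b + u)) (at t within {0..}) \<and>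
          (w has_vector_derivative (- w t + (x t \<bullet> x t) *\<^sub>R e)) (at t within {0..}) \<and>
          (K has_vector_derivative outer_product e (x t)) (at t within {0..}))"

end

theory Submission
  imports Defs
begin

text \<open>Put \<open>N = aP\<close>, \<open>D = K - N\<close> and \<open>V = (|e|\<^sup>2 + |D|\<^sup>2)/2\<close>. Then \<open>e' = -(1 + |x|\<^sup>2) e - D x\<close> and
  \<open>D' = e x\<^sup>T\<close>, so that \<open>V' = -(1 + |x|\<^sup>2) |e|\<^sup>2\<close>. The term \<open>D x\<close>, which need not be small a priori,
  cancels in the shifted deviation \<open>y = x + e - xo\<close> from the optimum \<open>xo\<close>:
  \<open>y' = -(I - 2N) y - 2N e - |x|\<^sup>2 e\<close>. As \<open>I - 2N \<ge> c I\<close> with \<open>c > 0\<close>, Young's inequality gives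
  \<open>(|y|\<^sup>2)' \<le> -c |y|\<^sup>2 - k V' (|y|\<^sup>2 + 1)\<close>, and hence \<open>(|y|\<^sup>2 + 1) exp (k V) + V\<close> is a Lyapunov
  function that decreases at rate at least \<open>c |y|\<^sup>2 + |e|\<^sup>2\<close>. It bounds all signals, which yields
  global existence, and a Barbalat argument yields \<open>y \<rightarrow> 0\<close> and \<open>e \<rightarrow> 0\<close>.\<close>

section \<open>Ordinary differential equations\<close>

text \<open>A derivative at \<open>t\<close> depends only on points near \<open>t\<close>, and
  \<open>t\<close> keeps distance one from the right end. This carries the fundamental theorem of
  calculus from compact intervals to the half-line.\<close>

lemma has_vector_derivative_at_Icc_imp_atLeast:
  fixes s :: "real \<Rightarrow> 'a::real_normed_vector"
  assumes "(s has_vector_derivative d) (at t within {0..t + 1})" "t \<ge> 0"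
  shows "(s has_vector_derivative d) (at t within {0..})"
proof -
  have "at t within {0..t+1} = at t within {0..}"
    by (rule at_within_nhd[of _ "{t - 1<..<t + 1}"]) auto
  then show ?thesis using assms by simp
qed

text \<open>The exponential weight turns the Picard operator into a contraction on the whole half-line at
  once; the argument \<open>max 0 t\<close> only serves to have functions on all of \<open>real\<close>.\<close>

lemma picard_bounded_lipschitz:
  fixes F :: "'a::euclidean_space \<Rightarrow> 'a"
  assumes lip: "L-lipschitz_on UNIV F" and bd: "\<And>v. norm (F v) \<le> B"
  obtains s where "s 0 = s0"
    "\<And>t. t \<ge> 0 \<Longrightarrow> (s has_vector_derivative F (s t)) (at t within {0..})"
proof -
  have L: "L \<ge> 0" using lipschitz_on_nonneg[OF lip] .
  have B: "B \<ge> 0" using bd[of 0] norm_ge_zero order_trans by blast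
  \<comment> \<open>This rate makes the contraction factor \<open>L / l\<close> at most
    \<open>1/2\<close>; the summand \<open>1\<close> keeps \<open>l\<close> positive when
    \<open>L = 0\<close>.\<close>
  define l where "l = 2 * L + 1"
  have l: "l > 0" "2 * L \<le> l" using L by (auto simp: l_def)
  have contF: "continuous_on S F" for S
    using lipschitz_on_continuous_on[OF lip] continuous_on_subset by blast
  \<comment> \<open>The unknown \<open>y\<close> is the solution damped by
    \<open>exp (- l * t)\<close>; \<open>G y\<close> evaluates the field along the undamped
    curve.\<close>
  define G where "G y t = F (exp (l * t) *\<^sub>R apply_bcontfun y t)" for y :: "real \<Rightarrow>\<^sub>C 'a" and t
  have contG: "continuous_on S (G y)" for S y
    unfolding G_def by (intro continuous_on_compose2[OF contF[of UNIV]] continuous_intros) auto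
  have der: "((\<lambda>u. integral {0..u} (G y)) has_vector_derivative G y t) (at t within {0..})"
    if "t \<ge> 0" for y t
    using that by (intro has_vector_derivative_at_Icc_imp_atLeast integral_has_vector_derivative contG) auto
  have contI: "continuous_on {0..} (\<lambda>u. integral {0..u} (G y))" for y
    unfolding continuous_on_eq_continuous_within
    using der by (metis atLeast_iff has_vector_derivative_continuous)
  define Q where "Q y t = exp (- l * max 0 t) *\<^sub>R (s0 + integral {0..max 0 t} (G y))" for y t
  have contQ: "continuous_on UNIV (Q y)" for y
    unfolding Q_def
    by (intro continuous_intros continuous_on_compose2[OF contI]) auto
  \<comment> \<open>As \<open>F\<close> is bounded by \<open>B\<close>, the integral grows at most
    linearly, and the weight \<open>exp (- l * m)\<close> beats that growth. So the operator maps
    into the bounded continuous functions.\<close>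
  have boundQ: "norm (Q y t) \<le> norm s0 + B / l" for y t
  proof -
    define m where "m = max 0 t"
    have m: "m \<ge> 0" by (simp add: m_def)
    have "norm (integral {0..m} (G y)) \<le> B * (m - 0)"
      by (rule integral_bound) (use m contG bd in \<open>auto simp: G_def\<close>)
    then have "norm (s0 + integral {0..m} (G y)) \<le> norm s0 + B * m"
      using norm_triangle_ineq[of s0 "integral {0..m} (G y)"] by simp
    then have "norm (Q y t) \<le> exp (- l * m) * (norm s0 + B * m)"
      unfolding Q_def m_def[symmetric] by (simp add: mult_left_mono)
    also have "\<dots> \<le> norm s0 + B / l"
    proof -
      have "exp (- l * m) * norm s0 \<le> 1 * norm s0"
        using l m by (intro mult_right_mono) auto
      moreover have "exp (- l * m) * m \<le> 1 / l"
      proof -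
        have "l * m \<le> exp (l * m)" using exp_ge_add_one_self[of "l * m"] by linarith
        then show ?thesis using l by (simp add: exp_minus field_simps)
      qed
      then have "B * (exp (- l * m) * m) \<le> B * (1 / l)" using B by (rule mult_left_mono)
      ultimately show ?thesis by (simp add: algebra_simps)
    qed
    finally show ?thesis .
  qed
  define \<Phi> where "\<Phi> y = Bcontfun (Q y)" for y
  have app: "apply_bcontfun (\<Phi> y) = Q y" for y
    unfolding \<Phi>_def by (rule Bcontfun_inverse) (rule bcontfun_normI[OF contQ boundQ])
  have contr: "dist (\<Phi> y1) (\<Phi> y2) \<le> 1/2 * dist y1 y2" for y1 y2
  proof (rule dist_bound)
    fix t :: real
    define m where "m = max 0 t"
    define d where "d = dist y1 y2"
    have m: "m \<ge> 0" by (simp add: m_def)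
    have d: "d \<ge> 0" by (simp add: d_def)
    have int: "G y integrable_on {0..m}" for y
      by (intro integrable_continuous_interval contG)
    have hi: "((\<lambda>\<tau>. (d / 2) * (l * exp (l * \<tau>))) has_integral (d / 2) * (exp (l * m) - exp (l * 0))) {0..m}"
      by (intro has_integral_mult_right fundamental_theorem_of_calculus m)
        (auto intro!: derivative_eq_intros simp flip: has_real_derivative_iff_has_vector_derivative)
    \<comment> \<open>Undoing the damping lets the distance of the two curves grow like
      \<open>exp (l * \<tau>)\<close>. Integration gains the factor \<open>1 / l\<close>, and the
      outer weight cancels the growth.\<close>
    have le: "norm (G y1 \<tau> - G y2 \<tau>) \<le> (d / 2) * (l * exp (l * \<tau>))" for \<tau>
    proof -
      have "norm (G y1 \<tau> - G y2 \<tau>) \<le> L * norm (exp (l * \<tau>) *\<^sub>R y1 \<tau> - exp (l * \<tau>) *\<^sub>R y2 \<tau>)"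
        unfolding G_def by (rule lipschitz_on_normD[OF lip]) auto
      also have "\<dots> = L * exp (l * \<tau>) * dist (y1 \<tau>) (y2 \<tau>)"
        by (simp add: dist_norm flip: scaleR_diff_right)
      also have "\<dots> \<le> (l / 2) * exp (l * \<tau>) * d"
        using l L d dist_bounded[of y1 \<tau> y2] unfolding d_def by (intro mult_mono) auto
      finally show ?thesis by (simp add: algebra_simps)
    qed
    have "norm (integral {0..m} (G y1) - integral {0..m} (G y2))
        = norm (integral {0..m} (\<lambda>\<tau>. G y1 \<tau> - G y2 \<tau>))"
      using int by (simp add: Henstock_Kurzweil_Integration.integral_diff)
    also have "\<dots> \<le> integral {0..m} (\<lambda>\<tau>. (d / 2) * (l * exp (l * \<tau>)))"
      by (rule integral_norm_bound_integral) (use hi le int in \<open>auto intro!: integrable_diff\<close>)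
    also have "\<dots> \<le> (d / 2) * exp (l * m)"
      unfolding integral_unique[OF hi] using d by (intro mult_left_mono) auto
    finally have *: "norm (integral {0..m} (G y1) - integral {0..m} (G y2)) \<le> (d / 2) * exp (l * m)" .
    have "dist (\<Phi> y1 t) (\<Phi> y2 t) =
       exp (- l * m) * norm (integral {0..m} (G y1) - integral {0..m} (G y2))"
      unfolding app Q_def m_def[symmetric] dist_norm by (simp flip: scaleR_diff_right)
    also have "\<dots> \<le> exp (- l * m) * ((d / 2) * exp (l * m))"
      using * by (intro mult_left_mono) auto
    also have "\<dots> = d / 2" by (simp add: exp_minus field_simps)
    finally show "dist (\<Phi> y1 t) (\<Phi> y2 t) \<le> 1/2 * dist y1 y2" by (simp add: d_def)
  qed
  obtain y where y: "\<Phi> y = y"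
    using banach_fix_type[of "1/2" \<Phi>] contr by auto
  define s where "s t = exp (l * t) *\<^sub>R apply_bcontfun y t" for t
  have s: "s t = s0 + integral {0..t} (G y)" if "t \<ge> 0" for t
  proof -
    have "y t = exp (- l * t) *\<^sub>R (s0 + integral {0..t} (G y))"
      using app[of y] that by (simp add: y Q_def)
    then show ?thesis by (simp add: s_def exp_minus)
  qed
  show ?thesis
  proof
    show "s 0 = s0" using s[of 0] by simp
    fix t :: real assume t: "t \<ge> 0"
    have "((\<lambda>u. s0 + integral {0..u} (G y)) has_vector_derivative G y t) (at t within {0..})"
      using der[OF t, of y] by (auto intro!: derivative_eq_intros)
    moreover have "G y t = F (s t)" by (simp add: G_def s_def)
    ultimately show "(s has_vector_derivative F (s t)) (at t within {0..})"
      using t by (auto intro: has_vector_derivative_transform s)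
  qed
qed

text \<open>Precomposing \<open>F\<close> with the projection onto the ball of radius
  \<open>R + 1\<close> gives a bounded, globally Lipschitz field, which has a global solution. The a
  priori bound \<open>R\<close> keeps that solution inside the ball, where the truncation is
  inactive.\<close>

lemma global_solution_of_apriori_bound:
  fixes F :: "'a::euclidean_space \<Rightarrow> 'a"
  assumes lip: "\<And>r. \<exists>L. L-lipschitz_on (cball 0 r) F"
    and apriori: "\<And>T s. T \<ge> 0 \<Longrightarrow> s 0 = s0 \<Longrightarrow>
      (\<And>t. t \<in> {0..T} \<Longrightarrow> (s has_vector_derivative F (s t)) (at t within {0..T})) \<Longrightarrow> norm (s T) \<le> R"
  shows "\<exists>s. s 0 = s0 \<and> (\<forall>t\<ge>0. (s has_vector_derivative F (s t)) (at t within {0..}))"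
proof -
  \<comment> \<open>For \<open>T = 0\<close> the derivative is taken within a single point and is
    unconstrained, so the constant curve qualifies.\<close>
  have R: "norm s0 \<le> R"
    using apriori[of 0 "\<lambda>_. s0"]
    by (simp add: has_vector_derivative_def has_derivative_within_singleton_iff
        bounded_linear_scaleR_left)
  define C where "C = cball (0::'a) (R + 1)"
  have C: "convex C" "closed C" "C \<noteq> {}" "compact C"
    using R norm_ge_zero[of s0] unfolding C_def by (auto intro: order_trans simp del: norm_ge_zero)
  obtain L where L: "L-lipschitz_on C F" using lip C_def by blast
  define G where "G v = F (closest_point C v)" for v
  have "1-lipschitz_on UNIV (closest_point C)"
    using closest_point_lipschitz[OF C(1-3)] by (auto intro: lipschitz_onI)
  moreover have "L-lipschitz_on (range (closest_point C)) F"
    by (rule lipschitz_on_subset[OF L]) (use closest_point_in_set[OF C(2,3)] in auto)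
  ultimately have lipG: "(L * 1)-lipschitz_on UNIV G"
    unfolding G_def by (rule lipschitz_on_compose2)
  have "bounded (F ` C)"
    using C(4) lipschitz_on_continuous_on[OF L] by (intro compact_imp_bounded compact_continuous_image)
  then obtain B where "\<And>v. v \<in> C \<Longrightarrow> norm (F v) \<le> B"
    unfolding bounded_iff by auto
  then have "norm (G v) \<le> B" for v
    unfolding G_def using closest_point_in_set[OF C(2,3)] by auto
  from picard_bounded_lipschitz[OF lipG this, of s0]
  obtain s where s0: "s 0 = s0"
    and s: "\<And>t. t \<ge> 0 \<Longrightarrow> (s has_vector_derivative G (s t)) (at t within {0..})" by blast
  have cont: "continuous_on {0..} s"
    unfolding continuous_on_eq_continuous_within
    using s by (metis atLeast_iff has_vector_derivative_continuous)
  have small: "norm (s t) < R + 1" if t: "t \<ge> 0" for t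
  proof (rule ccontr)
    assume neg: "\<not> norm (s t) < R + 1"
    \<comment> \<open>The least element \<open>T\<close> of the closed set \<open>A\<close> is the
      first time at which the norm reaches \<open>R + 1\<close>. On \<open>{0..T}\<close> the curve
      solves the original equation, so its norm at \<open>T\<close> is at most \<open>R\<close>, a
      contradiction.\<close>
    define A where "A = {0..t} \<inter> {u. R + 1 \<le> norm (s u)}"
    have "closed A"
      unfolding A_def
      using continuous_on_closed_Collect_le[of "{0..t}" "\<lambda>_. R + 1" "\<lambda>u. norm (s u)"]
      by (simp add: Int_def continuous_on_norm continuous_on_subset[OF cont])
    then have cA: "compact A" unfolding compact_eq_bounded_closed
      by (auto simp: A_def intro: bounded_subset[OF bounded_closed_interval])
    have "A \<noteq> {}" using neg t by (auto simp: A_def)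
    from compact_attains_inf[OF cA this]
    obtain T where T: "T \<in> A" "\<And>u. u \<in> A \<Longrightarrow> T \<le> u" by auto
    have T0: "T \<ge> 0" "T \<le> t" "R + 1 \<le> norm (s T)" using T(1) by (auto simp: A_def)
    have before: "norm (s u) < R + 1" if "u \<in> {0..<T}" for u
      using T(2)[of u] that T0 by (force simp: A_def)
    have cT: "continuous_on {0..T} (\<lambda>u. norm (s u))"
      by (intro continuous_intros continuous_on_subset[OF cont]) auto
    \<comment> \<open>The end point \<open>T\<close> must be included; continuity extends the strict
      bound on \<open>{0..<T}\<close> to it unless \<open>T = 0\<close>, where the initial state
      decides.\<close>
    have le: "norm (s u) \<le> R + 1" if "u \<in> {0..T}" for u
    proof (cases "T = 0")
      case True then show ?thesis using that R s0 by auto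
    next
      case False
      then have "closure {0..<T} = {0..T}" using T0 by simp
      then show ?thesis
        using continuous_le_on_closure[of "{0..<T}" "\<lambda>u. norm (s u)" u "R + 1"] cT that before
        by (simp add: less_imp_le)
    qed
    have "norm (s T) \<le> R"
    proof (rule apriori[where s = s and T = T])
      fix u assume u: "u \<in> {0..T}"
      then have "G (s u) = F (s u)"
        unfolding G_def using le by (simp add: closest_point_self C_def)
      then show "(s has_vector_derivative F (s u)) (at u within {0..T})"
        using s[of u] u by (auto intro: has_vector_derivative_within_subset)
    qed (use T0 s0 in auto)
    then show False using T0 by simp
  qed
  show ?thesis
  proof (intro exI[of _ s] conjI allI impI)
    show "s 0 = s0" by fact
    fix t :: real assume "t \<ge> 0"
    moreover have "G (s t) = F (s t)"
      unfolding G_def using small[OF \<open>t \<ge> 0\<close>] by (simp add: closest_point_self C_def)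
    ultimately show "(s has_vector_derivative F (s t)) (at t within {0..})"
      using s[of t] by simp
  qed
qed

text \<open>Both factors are bounded on a compact set, so splitting the increment as in the product
  rule gives a Lipschitz constant. Iterated, this handles the polynomial terms of the closed
  loop.\<close>

lemma lipschitz_on_bounded_bilinear:
  fixes prod :: "'a::real_normed_vector \<Rightarrow> 'b::real_normed_vector \<Rightarrow> 'c::real_normed_vector"
  assumes prod: "bounded_bilinear prod" and S: "compact S"
    and f: "\<exists>L. L-lipschitz_on S f" and g: "\<exists>L. L-lipschitz_on S g"
  shows "\<exists>L. L-lipschitz_on S (\<lambda>x. prod (f x) (g x))"
proof -
  interpret bounded_bilinear prod by fact
  obtain Lf Lg where L: "Lf-lipschitz_on S f" "Lg-lipschitz_on S g" using f g by blast
  have "bounded (f ` S)" "bounded (g ` S)"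
    using L lipschitz_on_continuous_on S compact_continuous_image compact_imp_bounded by blast+
  then obtain Bf Bg where B: "Bf > 0" "Bg > 0"
    "\<And>x. x \<in> S \<Longrightarrow> norm (f x) \<le> Bf" "\<And>x. x \<in> S \<Longrightarrow> norm (g x) \<le> Bg"
    unfolding bounded_pos by auto
  obtain K where K: "K > 0" "\<And>a b. norm (prod a b) \<le> norm a * norm b * K" using pos_bounded by blast
  have nn: "Lf \<ge> 0" "Lg \<ge> 0" using L lipschitz_on_nonneg by blast+
  have "(Lf * Bg * K + Bf * Lg * K)-lipschitz_on S (\<lambda>x. prod (f x) (g x))"
  proof (rule lipschitz_onI)
    fix x y assume x: "x \<in> S" "y \<in> S"
    have "prod (f x) (g x) - prod (f y) (g y) = prod (f x - f y) (g x) + prod (f y) (g x - g y)"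
      by (simp add: diff_left diff_right)
    then have "dist (prod (f x) (g x)) (prod (f y) (g y))
        \<le> norm (prod (f x - f y) (g x)) + norm (prod (f y) (g x - g y))"
      by (simp add: dist_norm norm_triangle_ineq)
    also have "\<dots> \<le> norm (f x - f y) * norm (g x) * K + norm (f y) * norm (g x - g y) * K"
      by (intro add_mono K)
    also have "\<dots> \<le> (Lf * dist x y) * Bg * K + Bf * (Lg * dist x y) * K"
      using K B nn x lipschitz_onD[OF L(1) x] lipschitz_onD[OF L(2) x]
      by (intro add_mono mult_mono) (auto simp: dist_norm)
    finally show "dist (prod (f x) (g x)) (prod (f y) (g y)) \<le> (Lf * Bg * K + Bf * Lg * K) * dist x y"
      by (simp add: algebra_simps)
  qed (use nn B K in auto)
  then show ?thesis by blast
qed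

section \<open>Monotonicity and dissipation\<close>

lemma antitone_of_nonpos_derivative_on_Icc:
  fixes f :: "real \<Rightarrow> real"
  assumes "a \<le> b" and der: "\<And>t. t \<in> {a..b} \<Longrightarrow> (f has_real_derivative f' t) (at t within {a..b})"
    and "\<And>t. t \<in> {a..b} \<Longrightarrow> f' t \<le> 0"
  shows "f b \<le> f a"
proof (rule DERIV_nonpos_imp_decreasing_open[OF \<open>a \<le> b\<close>])
  fix t assume t: "a < t" "t < b"
  then have "at t within {a..b} = at t" by (simp add: at_within_Icc_at)
  then show "\<exists>y. DERIV f t :> y \<and> y \<le> 0" using der[of t] assms(3)[of t] t by auto
next
  show "continuous_on {a..b} f"
    unfolding continuous_on_eq_continuous_within using der DERIV_continuous by blast
qed

text \<open>A variant of Barbalat's lemma: by the mean value theorem on \<open>[t, t + d]\<close> a decrease of \<open>L\<close>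
  controls \<open>f t\<close> up to \<open>C * d\<close>, while \<open>L t - L (t + d)\<close> tends to zero.\<close>

lemma tendsto_zero_of_dissipation:
  fixes L f :: "real \<Rightarrow> real"
  assumes L: "\<And>t. t \<ge> 0 \<Longrightarrow> (L has_real_derivative L' t) (at t within {0..})"
    and L': "\<And>t. t \<ge> 0 \<Longrightarrow> L' t \<le> - f t"
    and Lnn: "\<And>t. t \<ge> 0 \<Longrightarrow> L t \<ge> 0"
    and fnn: "\<And>t. t \<ge> 0 \<Longrightarrow> f t \<ge> 0"
    and f: "\<And>t. t \<ge> 0 \<Longrightarrow> (f has_real_derivative f' t) (at t within {0..})"
    and f': "\<And>t. t \<ge> 0 \<Longrightarrow> - C \<le> f' t" and C: "C > 0"
  shows "(f \<longlongrightarrow> 0) at_top"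
proof -
  have slow: "f t - C * (u - t) \<le> f u" if "0 \<le> t" "t \<le> u" for t u
  proof -
    have "- (f u + C * u) \<le> - (f t + C * t)"
    proof (rule antitone_of_nonpos_derivative_on_Icc[OF \<open>t \<le> u\<close>])
      fix v assume v: "v \<in> {t..u}"
      then have "(f has_real_derivative f' v) (at v within {t..u})"
        using f[of v] that by (auto intro: has_field_derivative_subset)
      then show "((\<lambda>u. - (f u + C * u)) has_real_derivative - (f' v + C)) (at v within {t..u})"
        by (auto intro!: derivative_eq_intros)
      show "- (f' v + C) \<le> 0" using f'[of v] v that by auto
    qed
    then show ?thesis by (simp add: algebra_simps)
  qed
  have drop: "L u \<le> L t - (u - t) * (f t - C * (u - t))" if "0 \<le> t" "t \<le> u" for t u
  proof -
    \<comment> \<open>By \<open>slow\<close>, \<open>q\<close> bounds \<open>f\<close> from below on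
      all of \<open>{t..u}\<close>, so \<open>L\<close> falls there at rate at least
      \<open>q\<close>.\<close>
    define q where "q = f t - C * (u - t)"
    have "L u + u * q \<le> L t + t * q"
    proof (rule antitone_of_nonpos_derivative_on_Icc[OF \<open>t \<le> u\<close>])
      fix v assume v: "v \<in> {t..u}"
      then have "(L has_real_derivative L' v) (at v within {t..u})"
        using L[of v] that by (auto intro: has_field_derivative_subset)
      then show "((\<lambda>u. L u + u * q) has_real_derivative L' v + q) (at v within {t..u})"
        by (auto intro!: derivative_eq_intros)
      have "q \<le> f t - C * (v - t)" using v that C by (auto simp: q_def intro!: mult_left_mono)
      then show "L' v + q \<le> 0" using L'[of v] slow[of t v] v that by auto
    qed
    then show ?thesis by (simp add: q_def algebra_simps)
  qed
  have mono: "L u \<le> L t" if "0 \<le> t" "t \<le> u" for t u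
  proof (rule antitone_of_nonpos_derivative_on_Icc[OF \<open>t \<le> u\<close>])
    fix v assume v: "v \<in> {t..u}"
    then show "(L has_real_derivative L' v) (at v within {t..u})"
      using L[of v] that by (auto intro: has_field_derivative_subset)
    show "L' v \<le> 0" using L'[of v] fnn[of v] v that by auto
  qed
  have bdd: "bdd_below (L ` {0..})" using Lnn by (auto intro!: bdd_belowI[of _ 0])
  define m where "m = Inf (L ` {0..})"
  have m: "m \<le> L t" if "t \<ge> 0" for t using bdd that unfolding m_def by (intro cInf_lower) auto
  show ?thesis
  proof (rule order_tendstoI)
    show "\<forall>\<^sub>F t in at_top. a < f t" if "a < 0" for a
      using eventually_ge_at_top[of 0] by eventually_elim (use fnn that in \<open>auto intro: less_le_trans\<close>)
    fix e :: real assume e: "e > 0"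
    \<comment> \<open>Over a time \<open>d\<close> the function \<open>f\<close> loses at most
      \<open>e / 2\<close>, so \<open>L\<close> drops by at least \<open>d * (f t - e / 2)\<close>.
      Once \<open>L\<close> is within \<open>d * (e / 2)\<close> of its infimum, this forces
      \<open>f t < e\<close>.\<close>
    define d where "d = e / (2 * C)"
    have d: "d > 0" "C * d = e / 2" using e C by (auto simp: d_def)
    have "m < m + d * (e / 2)" using d e by simp
    then obtain T where T: "T \<ge> 0" "L T < m + d * (e / 2)"
      using cInf_lessD[of "L ` {0..}" "m + d * (e / 2)"] by (auto simp: m_def)
    have "f t < e" if "t \<ge> T" for t
    proof -
      have "m \<le> L t - d * (f t - e / 2)"
        using drop[of t "t + d"] m[of "t + d"] T that d by auto
      then have "d * (f t - e / 2) < d * (e / 2)" using mono[of T t] T that by linarith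
      then show ?thesis using d by simp
    qed
    then show "\<forall>\<^sub>F t in at_top. f t < e" by (auto simp: eventually_at_top_linorder)
  qed
qed

section \<open>Symmetric matrices and the social optimum\<close>

lemma symmetric_matrix_inner:
  fixes A :: "real^'n^'n"
  assumes "transpose A = A"
  shows "u \<bullet> (A *v v) = (A *v u) \<bullet> v"
  by (metis assms dot_lmul_matrix vector_transpose_matrix)

text \<open>Eigenvectors of a symmetric matrix for distinct eigenvalues are orthogonal, and pairwise
  orthogonal sets are finite. Finiteness makes \<open>Max\<close> over the spectrum an upper
  bound.\<close>

lemma finite_spectrum_of_symmetric:
  fixes A :: "real^'n^'n"
  assumes sym: "transpose A = A"
  shows "finite (spectrum A)"
proof -
  have "\<forall>l\<in>spectrum A. \<exists>v. v \<noteq> 0 \<and> A *v v = l *\<^sub>R v"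
    by (simp add: spectrum_def eigenvalue_def)
  from bchoice[OF this] obtain f
    where f: "\<And>l. l \<in> spectrum A \<Longrightarrow> f l \<noteq> 0 \<and> A *v f l = l *\<^sub>R f l" by auto
  have orth: "orthogonal (f k) (f l)" if "k \<in> spectrum A" "l \<in> spectrum A" "k \<noteq> l" for k l
    using symmetric_matrix_inner[OF sym, of "f k" "f l"] f that by (auto simp: orthogonal_def)
  have "inj_on f (spectrum A)"
    using orth f by (metis inj_onI orthogonal_self)
  moreover have "finite (f ` spectrum A)"
    using orth by (intro pairwise_orthogonal_imp_finite) (auto simp: pairwise_def)
  ultimately show ?thesis using finite_imageD by blast
qed

text \<open>A maximiser of the quadratic form on the unit sphere is an eigenvector.\<close>

lemma max_rayleigh_quotient_is_eigenvalue:
  fixes A :: "real^'n^'n"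
  assumes sym: "transpose A = A"
  obtains m where "m \<in> spectrum A" "\<And>v. v \<bullet> (A *v v) \<le> m * (v \<bullet> v)"
proof -
  define q where "q v = v \<bullet> (A *v v)" for v
  have "continuous_on (sphere 0 1) q"
    unfolding q_def by (intro continuous_intros linear_continuous_on_compose[OF _ matrix_vector_mul_linear])
  moreover have "sphere 0 1 \<noteq> ({} :: (real^'n) set)" by (simp add: sphere_empty)
  ultimately obtain v0 where v0: "norm v0 = 1" and max: "\<And>v. norm v = 1 \<Longrightarrow> q v \<le> q v0"
    using continuous_attains_sup[of "sphere 0 1" q] by auto
  define m where "m = q v0"
  have le: "q v \<le> m * (v \<bullet> v)" for v
  proof (cases "v = 0")
    case True then show ?thesis by (simp add: q_def)
  next
    case False
    have "q v = (v \<bullet> v) * q ((1 / norm v) *\<^sub>R v)"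
      using False by (simp add: q_def matrix_vector_mult_scaleR dot_square_norm power2_eq_square)
    moreover have "q ((1 / norm v) *\<^sub>R v) \<le> m" using max[of "(1 / norm v) *\<^sub>R v"] False by (simp add: m_def)
    ultimately show ?thesis by (metis inner_ge_zero mult.commute mult_left_mono)
  qed
  have "A *v v0 = m *\<^sub>R v0"
  proof (rule ccontr)
    \<comment> \<open>If the residual \<open>u\<close> were nonzero, moving from \<open>v0\<close>
      in direction \<open>u\<close> would raise the Rayleigh quotient to first order, against
      maximality.\<close>
    define u where "u = A *v v0 - m *\<^sub>R v0"
    assume "A *v v0 \<noteq> m *\<^sub>R v0"
    then have u: "u \<bullet> u > 0" by (simp add: u_def)
    have v0u: "u \<bullet> (A *v v0) = u \<bullet> u + m * (u \<bullet> v0)"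
      by (simp add: u_def inner_diff_right inner_diff_left algebra_simps)
    have one: "v0 \<bullet> v0 = 1" using v0 by (simp add: dot_square_norm)
    have "2 * t * (u \<bullet> u) \<le> t\<^sup>2 * (m * (u \<bullet> u) - q u)" for t
    proof -
      have sw: "v0 \<bullet> (A *v u) = u \<bullet> (A *v v0)"
        using symmetric_matrix_inner[OF sym, of v0 u] by (simp add: inner_commute)
      have "q (v0 + t *\<^sub>R u) = q v0 + 2 * t * (u \<bullet> (A *v v0)) + t\<^sup>2 * q u"
        by (simp add: q_def matrix_vector_right_distrib matrix_vector_mult_scaleR inner_add_left
            inner_add_right sw algebra_simps power2_eq_square)
      moreover have nn: "(v0 + t *\<^sub>R u) \<bullet> (v0 + t *\<^sub>R u) = 1 + 2 * t * (u \<bullet> v0) + t\<^sup>2 * (u \<bullet> u)"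
        by (simp add: inner_add_left inner_add_right one inner_commute algebra_simps power2_eq_square)
      ultimately show ?thesis
        using le[of "v0 + t *\<^sub>R u", unfolded nn] by (simp add: v0u m_def[symmetric] algebra_simps)
    qed
    then have *: "t * (2 * (u \<bullet> u)) \<le> t * (t * (m * (u \<bullet> u) - q u))" for t
      by (simp add: power2_eq_square mult.assoc mult.left_commute)
    define p where "p = m * (u \<bullet> u) - q u"
    have **: "2 * (u \<bullet> u) \<le> t * p" if "t > 0" for t
      using *[of t] that by (simp add: p_def)
    \<comment> \<open>The step is short enough for the second-order term \<open>t * p\<close> to
      stay below \<open>u \<bullet> u\<close>; the summand \<open>1\<close> guards against
      \<open>p = 0\<close>.\<close>
    define t where "t = (u \<bullet> u) / (\<bar>p\<bar> + 1)"
    have "t > 0" using u by (simp add: t_def)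
    moreover have "t * p \<le> u \<bullet> u"
    proof -
      have "(u \<bullet> u) * (p / (\<bar>p\<bar> + 1)) \<le> (u \<bullet> u) * 1"
        using u by (intro mult_left_mono) (auto simp: divide_le_eq)
      then show ?thesis by (simp add: t_def)
    qed
    ultimately show False using **[of t] u by auto
  qed
  then have "m \<in> spectrum A" using v0 by (auto simp: spectrum_def eigenvalue_def intro!: exI[of _ v0])
  then show ?thesis using that le by (auto simp: q_def)
qed

text \<open>Taking the top Rayleigh value \<open>m\<close> of the scaled matrix
  \<open>a *\<^sub>R S\<close> covers both signs of \<open>a\<close>: \<open>m / a\<close> is an
  eigenvalue of \<open>S\<close>, hence \<open>m < 1\<close>, and \<open>c = 1 - m\<close>
  works.\<close>

lemma coercive_of_spectrum_bound:
  fixes S :: "real^'n^'n"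
  assumes sym: "transpose S = S" and a: "a \<noteq> 0" and Max: "Max ((\<lambda>l. a * l) ` spectrum S) < 1"
  obtains c where "c > 0" "\<And>v. c * (v \<bullet> v) \<le> v \<bullet> (v - a *\<^sub>R (S *v v))"
proof -
  have "transpose (a *\<^sub>R S) = a *\<^sub>R S" using sym by (simp add: transpose_def vec_eq_iff)
  then obtain m where m: "m \<in> spectrum (a *\<^sub>R S)" "\<And>v. v \<bullet> ((a *\<^sub>R S) *v v) \<le> m * (v \<bullet> v)"
    using max_rayleigh_quotient_is_eigenvalue by metis
  from m(1) obtain v where "v \<noteq> 0" and v: "a *\<^sub>R (S *v v) = m *\<^sub>R v"
    by (auto simp: spectrum_def eigenvalue_def scaleR_matrix_vector_assoc)
  have "S *v v = (m / a) *\<^sub>R v"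
    using arg_cong[OF v, of "\<lambda>u. (1 / a) *\<^sub>R u"] a by simp
  then have "m / a \<in> spectrum S" using \<open>v \<noteq> 0\<close> by (auto simp: spectrum_def eigenvalue_def)
  then have "m \<in> (\<lambda>l. a * l) ` spectrum S" using a by (auto intro!: image_eqI[of _ _ "m / a"])
  then have "m < 1"
    using Max finite_spectrum_of_symmetric[OF sym] by (metis Max_ge finite_imageI le_less_trans)
  moreover have "(1 - m) * (v \<bullet> v) \<le> v \<bullet> (v - a *\<^sub>R (S *v v))" for v
    using m(2)[of v] by (simp add: scaleR_matrix_vector_assoc inner_diff_right algebra_simps)
  ultimately show ?thesis using that[of "1 - m"] by auto
qed

section \<open>The social optimum as the solution of a linear system\<close>

lemma social_welfare_eq:
  "social_welfare P a b y = y \<bullet> b + a * (y \<bullet> (P *v y)) - (y \<bullet> y) / 2"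
proof -
  have row: "(P *v y) $ i = (\<Sum>j\<in>UNIV. P $ i $ j * y $ j)" for i
    by (simp add: matrix_vector_mult_def)
  have "social_welfare P a b y = (\<Sum>i\<in>UNIV. y $ i * b $ i + a * (y $ i * (P *v y) $ i) - y $ i * y $ i / 2)"
    unfolding social_welfare_def row[symmetric]
    by (intro sum.cong refl) (simp add: power2_eq_square field_simps)
  then show ?thesis
    by (simp add: inner_vec_def sum.distrib sum_subtractf sum_distrib_left sum_divide_distrib)
qed

text \<open>The welfare is \<open>y \<bullet> b - (y \<bullet> H y) / 2\<close> with
  \<open>H = I - 2aP\<close>. Coercivity makes \<open>H\<close> bijective, and the solution of
  \<open>H xo = b\<close> is the only maximiser, so the \<open>THE\<close> in the definition denotes
  it.\<close>

lemma social_optimum_solves: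
  fixes P :: "real^'n^'n"
  assumes sym: "transpose P = P" and c: "c > 0"
    and coer: "\<And>v. c * (v \<bullet> v) \<le> v \<bullet> (v - (2 * a) *\<^sub>R (P *v v))"
  shows "social_optimum P a b - (2 * a) *\<^sub>R (P *v social_optimum P a b) = b"
proof -
  define H where "H v = v - (2 * a) *\<^sub>R (P *v v)" for v
  have lin: "linear H" unfolding H_def
    by (rule linearI) (simp_all add: matrix_vector_right_distrib matrix_vector_mult_scaleR algebra_simps)
  have zero: "v = 0" if "v \<bullet> H v \<le> 0" for v
  proof -
    have "c * (v \<bullet> v) \<le> 0" using coer[of v] that by (simp add: H_def)
    then have "v \<bullet> v \<le> 0" using c by (simp add: mult_le_0_iff)
    then show ?thesis by (metis inner_ge_zero inner_eq_zero_iff order_antisym)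
  qed
  then have "inj H"
    using lin by (metis inner_zero_right linear_injective_0 order_refl)
  then have "surj H" using lin linear_injective_imp_surjective by blast
  then obtain xo where xo: "H xo = b" by (metis surjD)
  \<comment> \<open>Completing the square around \<open>xo\<close>: the welfare loss is exactly half
    the quadratic form of \<open>H\<close> at \<open>y - xo\<close>.\<close>
  have gap: "social_welfare P a b xo - social_welfare P a b y = ((y - xo) \<bullet> H (y - xo)) / 2" for y
  proof -
    have sw: "xo \<bullet> (P *v y) = y \<bullet> (P *v xo)"
      using symmetric_matrix_inner[OF sym, of xo y] by (simp add: inner_commute)
    show ?thesis
      unfolding social_welfare_eq xo[symmetric] H_def
      by (simp add: matrix_vector_mult_diff_distrib inner_diff_left inner_diff_right sw
          inner_commute[of y xo] distrib_left right_diff_distrib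
          add_divide_distrib diff_divide_distrib)
  qed
  have "social_optimum P a b = xo"
    unfolding social_optimum_def
  proof (rule the_equality)
    have "0 \<le> (y - xo) \<bullet> H (y - xo)" for y
      using order_trans[OF mult_nonneg_nonneg[OF less_imp_le[OF c] inner_ge_zero] coer[of "y - xo"]]
      by (simp add: H_def)
    then have "social_welfare P a b y \<le> social_welfare P a b xo" for y
      using gap[of y] by (metis diff_ge_0_iff_ge divide_nonneg_pos zero_less_numeral)
    then show "is_arg_max (social_welfare P a b) (\<lambda>_. True) xo"
      by (simp add: is_arg_max_linorder)
    fix y assume "is_arg_max (social_welfare P a b) (\<lambda>_. True) y"
    then have "social_welfare P a b xo \<le> social_welfare P a b y"
      by (simp add: is_arg_max_linorder)
    then have "(y - xo) \<bullet> H (y - xo) \<le> 0" using gap[of y] by simp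
    then have "y - xo = 0" by (rule zero)
    then show "y = xo" by simp
  qed
  then show ?thesis using xo by (simp add: H_def)
qed

section \<open>Outer products and the Frobenius norm\<close>

lemma outer_product_mult_vec: "outer_product u v *v w = (v \<bullet> w) *\<^sub>R u"
  by (simp add: outer_product_def matrix_vector_mult_def inner_vec_def vec_eq_iff sum_distrib_left
      sum_distrib_right mult_ac)

lemma inner_outer_product: "A \<bullet> outer_product u v = u \<bullet> (A *v v)"
  for A :: "real^'n^'n"
  by (simp add: outer_product_def matrix_vector_mult_def inner_vec_def sum_distrib_left mult_ac)

lemma norm_outer_product: "norm (outer_product u v) = norm u * norm v"
  by (simp add: norm_eq_sqrt_inner inner_outer_product outer_product_mult_vec real_sqrt_mult)

text \<open>The norm on matrices here is the Frobenius norm, so Cauchy-Schwarz against the outer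
  product of \<open>A *v v\<close> and \<open>v\<close> gives the bound after cancelling
  \<open>norm (A *v v)\<close>.\<close>

lemma norm_matrix_vector_mult_le: "norm (A *v v) \<le> norm A * norm v" for A :: "real^'n^'n"
proof -
  have "norm (A *v v) * norm (A *v v) = A \<bullet> outer_product (A *v v) v"
    by (simp add: inner_outer_product flip: power2_eq_square power2_norm_eq_inner)
  also have "\<dots> \<le> norm A * (norm (A *v v) * norm v)"
    using norm_cauchy_schwarz[of A "outer_product (A *v v) v"] by (simp add: norm_outer_product)
  finally have "norm (A *v v) * norm (A *v v) \<le> norm (A *v v) * (norm A * norm v)" by (simp add: mult_ac)
  then show ?thesis
    by (cases "A *v v = 0") auto
qed

lemma bounded_bilinear_matrix_vector_mult:
  "bounded_bilinear ((*v) :: real^'n^'n \<Rightarrow> real^'n \<Rightarrow> real^'n)"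
proof
  show "\<exists>K. \<forall>a b. norm ((a :: real^'n^'n) *v b) \<le> norm a * norm b * K"
    by (rule exI[of _ 1]) (simp add: norm_matrix_vector_mult_le)
qed (simp_all add: matrix_vector_mult_add_rdistrib matrix_vector_right_distrib scaleR_matrix_vector_assoc
    matrix_vector_mult_scaleR)

lemma bounded_bilinear_outer_product:
  "bounded_bilinear (outer_product :: real^'n \<Rightarrow> real^'n \<Rightarrow> real^'n^'n)"
proof
  show "\<exists>K. \<forall>a b. norm (outer_product (a :: real^'n) b) \<le> norm a * norm b * K"
    by (rule exI[of _ 1]) (simp add: norm_outer_product)
qed (simp_all add: outer_product_def vec_eq_iff algebra_simps)

section \<open>The closed loop\<close>

lemma has_real_derivative_inner:
  fixes f g :: "real \<Rightarrow> 'a::real_inner"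
  assumes "(f has_vector_derivative f') (at t within S)" "(g has_vector_derivative g') (at t within S)"
  shows "((\<lambda>t. f t \<bullet> g t) has_real_derivative (f t \<bullet> g' + f' \<bullet> g t)) (at t within S)"
  unfolding has_real_derivative_iff_has_vector_derivative
  by (rule bounded_bilinear.has_vector_derivative[OF bounded_bilinear_inner assms])

lemma norm_diff_add_le: "norm (u - v + w) \<le> norm u + norm v + norm w"
  for u v w :: "'a::real_normed_vector"
  by (rule order_trans[OF norm_triangle_ineq]) (simp add: norm_triangle_ineq4)

text \<open>The weight \<open>c / 4\<close> is small enough for three cross terms to be absorbed by
  the decay rate \<open>2 * c\<close>, with more than \<open>c\<close> left over.\<close>

lemma weighted_young:
  fixes p q c :: real
  assumes "c > 0"
  shows "2 * p * q \<le> c / 4 * p\<^sup>2 + 4 / c * q\<^sup>2"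
proof -
  have "0 \<le> (c / 2 * p - 2 * q)\<^sup>2 / c" using assms by simp
  also have "\<dots> = c / 4 * p\<^sup>2 + 4 / c * q\<^sup>2 - 2 * p * q"
    using assms by (simp add: power2_eq_square field_simps)
  finally show ?thesis by simp
qed

text \<open>Here \<open>N\<close> stands for \<open>a *\<^sub>R P\<close> and \<open>xo\<close> for the social optimum.\<close>

locale coercive_game =
  fixes N :: "real^'n^'n" and b xo :: "real^'n" and c :: real
  assumes c: "c > 0"
    and coercive: "\<And>v. c * (v \<bullet> v) \<le> v \<bullet> (v - 2 *\<^sub>R (N *v v))"
    and xo: "xo - 2 *\<^sub>R (N *v xo) = b"
begin

text \<open>The loop with \<open>u = K x\<close> substituted. The time set is a parameter because a
  priori bounds concern \<open>{0..T}\<close> and convergence concerns \<open>{0..}\<close>.\<close>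

definition solution_on ::
  "real set \<Rightarrow> (real \<Rightarrow> real^'n) \<Rightarrow> (real \<Rightarrow> real^'n) \<Rightarrow> (real \<Rightarrow> real^'n) \<Rightarrow> (real \<Rightarrow> real^'n^'n) \<Rightarrow> bool"
where
  "solution_on S x z w K \<longleftrightarrow> (\<forall>t\<in>S.
     (x has_vector_derivative (N *v x t - x t + b + K t *v x t)) (at t within S) \<and>
     (z has_vector_derivative (2 *\<^sub>R (K t *v x t) + b - z t)) (at t within S) \<and>
     (w has_vector_derivative ((x t \<bullet> x t) *\<^sub>R (x t - z t - w t) - w t)) (at t within S) \<and>
     (K has_vector_derivative outer_product (x t - z t - w t) (x t)) (at t within S))"

lemma solution_on_subset:
  assumes "solution_on S x z w K" "T \<subseteq> S"
  shows "solution_on T x z w K"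
  using assms unfolding solution_on_def
  by (auto intro: has_vector_derivative_within_subset)

section \<open>Error signals, the Lyapunov function and their derivatives\<close>

definition "err x z w = x - z - w" for x z w :: "real^'n"
definition "V x z w K = (err x z w \<bullet> err x z w + (K - N) \<bullet> (K - N)) / 2"
definition "dev x z w = x + err x z w - xo"
definition "W x z w = dev x z w \<bullet> dev x z w"
text \<open>This is \<open>4 / c\<close> times the sum of the coefficients from the three Young
  estimates in \<open>dev_dissipation\<close>; \<open>sqrt (2 * v)\<close> bounds the error while
  \<open>V \<le> v\<close>.\<close>

definition "gain v = (16 * (norm N)\<^sup>2 + 4 + 4 * (sqrt (2 * v) + norm xo)\<^sup>2) / c"
text \<open>The exponential is an integrating factor for growth proportional to
  \<open>W + 1\<close>; the added \<open>V\<close> supplies decay in the error.\<close>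

definition "lyap k x z w K = (W x z w + 1) * exp (k * V x z w K) + V x z w K"

lemma V_nonneg: "V x z w K \<ge> 0"
  by (simp add: V_def)

lemma W_nonneg: "W x z w \<ge> 0"
  by (simp add: W_def)

lemma
  assumes "V x z w K \<le> v"
  shows norm_err_le: "norm (err x z w) \<le> sqrt (2 * v)"
    and norm_gap_le: "norm (K - N) \<le> sqrt (2 * v)"
proof -
  have le: "p \<le> 2 * v" "q \<le> 2 * v" if "(p + q) / 2 \<le> v" "p \<ge> 0" "q \<ge> 0" for p q
    using that by simp_all
  have "err x z w \<bullet> err x z w \<le> 2 * v" "(K - N) \<bullet> (K - N) \<le> 2 * v"
    by (rule le[OF assms[unfolded V_def] inner_ge_zero inner_ge_zero])+
  then show "norm (err x z w) \<le> sqrt (2 * v)" "norm (K - N) \<le> sqrt (2 * v)"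
    by (simp_all add: norm_eq_sqrt_inner)
qed

text \<open>The input \<open>b\<close> cancels between \<open>x\<close> and \<open>z\<close>, and
  the doubled \<open>K x\<close> in the equation of \<open>z\<close> leaves only the mismatch
  \<open>K - N\<close> as a forcing term.\<close>

lemma err_derivative:
  assumes "solution_on S x z w K" "t \<in> S"
  defines "e \<equiv> err (x t) (z t) (w t)"
  shows "((\<lambda>t. err (x t) (z t) (w t)) has_vector_derivative
    - (1 + x t \<bullet> x t) *\<^sub>R e - (K t - N) *v x t) (at t within S)"
proof -
  have "((\<lambda>t. x t - z t - w t) has_vector_derivative
     (N *v x t - x t + b + K t *v x t) - (2 *\<^sub>R (K t *v x t) + b - z t)
       - ((x t \<bullet> x t) *\<^sub>R (x t - z t - w t) - w t)) (at t within S)"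
    using assms by (intro has_vector_derivative_diff) (auto simp: solution_on_def)
  moreover have "(N *v x t - x t + b + K t *v x t) - (2 *\<^sub>R (K t *v x t) + b - z t)
       - ((x t \<bullet> x t) *\<^sub>R (x t - z t - w t) - w t) = - (1 + x t \<bullet> x t) *\<^sub>R e - (K t - N) *v x t"
    by (simp add: e_def err_def matrix_vector_mult_diff_rdistrib scaleR_2 algebra_simps)
  ultimately show ?thesis by (simp add: err_def)
qed

text \<open>The adaptation law is the one for which the two cross terms cancel: by
  \<open>inner_outer_product\<close>, the contribution of \<open>K - N\<close> is the negative of
  the forcing term in the error equation.\<close>

lemma V_derivative:
  assumes sol: "solution_on S x z w K" and t: "t \<in> S"
  defines "e \<equiv> err (x t) (z t) (w t)"
  shows "((\<lambda>t. V (x t) (z t) (w t) (K t)) has_real_derivative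
    - ((1 + x t \<bullet> x t) * (e \<bullet> e))) (at t within S)"
proof -
  have K: "((\<lambda>t. K t - N) has_vector_derivative outer_product e (x t)) (at t within S)"
    using sol t by (auto simp: solution_on_def e_def err_def intro!: derivative_eq_intros)
  define e' where "e' = - (1 + x t \<bullet> x t) *\<^sub>R e - (K t - N) *v x t"
  note E = err_derivative[OF sol t, folded e_def, folded e'_def]
  have D: "(K t - N) \<bullet> outer_product e (x t) = e \<bullet> ((K t - N) *v x t)"
    by (rule inner_outer_product)
  have "e \<bullet> e' = - ((1 + x t \<bullet> x t) * (e \<bullet> e)) - e \<bullet> ((K t - N) *v x t)"
    unfolding e'_def inner_diff_right by (simp add: left_diff_distrib distrib_right)
  then have "(e \<bullet> e' + e' \<bullet> e + ((K t - N) \<bullet> outer_product e (x t) + outer_product e (x t) \<bullet> (K t - N))) / 2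
    = - ((1 + x t \<bullet> x t) * (e \<bullet> e))"
    unfolding D inner_commute[of e' e] inner_commute[of "outer_product e (x t)" "K t - N"] by simp
  with DERIV_cdivide[OF DERIV_add[OF has_real_derivative_inner[OF E E] has_real_derivative_inner[OF K K]], of 2]
  show ?thesis unfolding V_def e_def[symmetric] by simp
qed

text \<open>Adding the error to \<open>x\<close> replaces the unknown \<open>K x\<close> by
  \<open>N x\<close>, so the coercive operator \<open>I - 2N\<close> governs the deviation; the
  equation for \<open>xo\<close> removes the constant terms.\<close>

lemma dev_derivative:
  assumes sol: "solution_on S x z w K" and t: "t \<in> S"
  defines "e \<equiv> err (x t) (z t) (w t)" and "y \<equiv> dev (x t) (z t) (w t)"
  shows "((\<lambda>t. dev (x t) (z t) (w t)) has_vector_derivative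
    - (y - 2 *\<^sub>R (N *v y)) - 2 *\<^sub>R (N *v e) - (x t \<bullet> x t) *\<^sub>R e) (at t within S)"
proof -
  have x: "(x has_vector_derivative (N *v x t - x t + b + K t *v x t)) (at t within S)"
    using sol t by (auto simp: solution_on_def)
  have "((\<lambda>t. x t + err (x t) (z t) (w t) - xo) has_vector_derivative
     (N *v x t - x t + b + K t *v x t) + (- (1 + x t \<bullet> x t) *\<^sub>R e - (K t - N) *v x t) - 0) (at t within S)"
    using x err_derivative[OF sol t, folded e_def]
    by (intro has_vector_derivative_diff has_vector_derivative_add has_vector_derivative_const)
  moreover have "(N *v x t - x t + b + K t *v x t) + (- (1 + x t \<bullet> x t) *\<^sub>R e - (K t - N) *v x t) - 0
    = - (y - 2 *\<^sub>R (N *v y)) - 2 *\<^sub>R (N *v e) - (x t \<bullet> x t) *\<^sub>R e"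
    unfolding xo[symmetric] y_def dev_def e_def[symmetric]
    by (simp add: matrix_vector_mult_diff_rdistrib matrix_vector_mult_diff_distrib
        matrix_vector_right_distrib scaleR_2 algebra_simps)
  ultimately show ?thesis by (simp add: dev_def)
qed

lemma dev_dissipation:
  fixes x e :: "real^'n"
  assumes e: "norm e \<le> sqrt (2 * v)"
  defines "y \<equiv> x + e - xo"
  shows "2 * (y \<bullet> (- (y - 2 *\<^sub>R (N *v y)) - 2 *\<^sub>R (N *v e) - (x \<bullet> x) *\<^sub>R e))
    \<le> - c * (y \<bullet> y) + gain v * ((1 + x \<bullet> x) * (e \<bullet> e)) * (y \<bullet> y + 1)"
proof -
  define Y X E n r where defs: "Y = norm y" "X = norm x" "E = norm e" "n = norm N" "r = sqrt (2 * v) + norm xo"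
  have nn: "Y \<ge> 0" "X \<ge> 0" "E \<ge> 0" "n \<ge> 0" by (simp_all add: defs)
  have "x = y - e + xo" by (simp add: y_def)
  then have "X \<le> Y + E + norm xo"
    using norm_diff_add_le[of y e xo] by (simp add: defs)
  then have X: "X \<le> Y + r" using e by (simp add: defs)
  have "\<bar>y \<bullet> (N *v e)\<bar> \<le> Y * (n * E)"
    using Cauchy_Schwarz_ineq2[of y "N *v e"] mult_left_mono[OF norm_matrix_vector_mult_le[of N e], of Y]
    by (simp add: defs)
  then have "- (y \<bullet> (N *v e)) \<le> Y * (n * E)" by (simp add: abs_le_iff)
  moreover have "2 * (y \<bullet> (- 2 *\<^sub>R (N *v e))) = 4 * - (y \<bullet> (N *v e))"
    "2 * Y * (2 * n * E) = 4 * (Y * (n * E))" by simp_all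
  ultimately have "2 * (y \<bullet> (- 2 *\<^sub>R (N *v e))) \<le> 2 * Y * (2 * n * E)" by linarith
  also have "\<dots> \<le> c / 4 * Y\<^sup>2 + 4 / c * (2 * n * E)\<^sup>2" by (rule weighted_young[OF c])
  finally have 1: "2 * (y \<bullet> (- 2 *\<^sub>R (N *v e))) \<le> c / 4 * Y\<^sup>2 + 4 / c * (2 * n * E)\<^sup>2" .
  have "- (y \<bullet> e) \<le> Y * E"
    using Cauchy_Schwarz_ineq2[of y e] by (simp add: defs abs_le_iff)
  then have "X\<^sup>2 * - (y \<bullet> e) \<le> X\<^sup>2 * (Y * E)" by (rule mult_left_mono) simp
  \<comment> \<open>Only one of the two factors \<open>X\<close> is traded for \<open>Y + r\<close>.
    The other stays next to \<open>E\<close>, so that Young's inequality produces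
    \<open>X\<^sup>2 * E\<^sup>2\<close>, which the decay of \<open>V\<close> controls.\<close>
  also have "\<dots> \<le> X * (Y + r) * (Y * E)"
    unfolding power2_eq_square using X nn by (intro mult_right_mono mult_left_mono) auto
  finally have "2 * (X\<^sup>2 * - (y \<bullet> e)) \<le> 2 * (X * (Y + r) * (Y * E))"
    by (rule mult_left_mono) simp
  moreover have "2 * (y \<bullet> (- (x \<bullet> x) *\<^sub>R e)) = 2 * (X\<^sup>2 * - (y \<bullet> e))"
    by (simp add: defs power2_norm_eq_inner)
  ultimately have "2 * (y \<bullet> (- (x \<bullet> x) *\<^sub>R e)) \<le> 2 * (X * (Y + r) * (Y * E))"
    by (simp only:)
  also have "2 * (X * (Y + r) * (Y * E)) = 2 * Y * (Y * (X * E)) + 2 * Y * (r * X * E)"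
    by (simp add: algebra_simps)
  also have "\<dots> \<le> (c / 4 * Y\<^sup>2 + 4 / c * (Y * (X * E))\<^sup>2) + (c / 4 * Y\<^sup>2 + 4 / c * (r * X * E)\<^sup>2)"
    by (intro add_mono weighted_young c)
  finally have 2: "2 * (y \<bullet> (- (x \<bullet> x) *\<^sub>R e))
    \<le> (c / 4 * Y\<^sup>2 + 4 / c * (Y * (X * E))\<^sup>2) + (c / 4 * Y\<^sup>2 + 4 / c * (r * X * E)\<^sup>2)" .
  have 3: "2 * (y \<bullet> (- (y - 2 *\<^sub>R (N *v y)))) \<le> - (2 * c) * Y\<^sup>2"
    using coercive[of y] by (simp add: defs power2_norm_eq_inner inner_diff_right)
  have sq: "y \<bullet> y = Y\<^sup>2" "x \<bullet> x = X\<^sup>2" "e \<bullet> e = E\<^sup>2" by (simp_all add: defs power2_norm_eq_inner)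
  have gain: "gain v = 4 / c * (4 * n\<^sup>2 + 1 + r\<^sup>2)" by (simp add: gain_def defs field_simps)
  have "2 * (y \<bullet> (- (y - 2 *\<^sub>R (N *v y)) - 2 *\<^sub>R (N *v e) - (x \<bullet> x) *\<^sub>R e))
    = 2 * (y \<bullet> (- (y - 2 *\<^sub>R (N *v y)))) + 2 * (y \<bullet> (- 2 *\<^sub>R (N *v e))) + 2 * (y \<bullet> (- (x \<bullet> x) *\<^sub>R e))"
    by (simp add: inner_diff_right algebra_simps)
  also have "\<dots> \<le> - c * Y\<^sup>2 + 4 / c * ((2 * n * E)\<^sup>2 + (Y * (X * E))\<^sup>2 + (r * X * E)\<^sup>2) - c / 4 * Y\<^sup>2"
    using 1 2 3 by (simp add: algebra_simps)
  also have "\<dots> \<le> - c * Y\<^sup>2 + 4 / c * ((2 * n * E)\<^sup>2 + (Y * (X * E))\<^sup>2 + (r * X * E)\<^sup>2)"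
    using c by simp
  finally have upper: "2 * (y \<bullet> (- (y - 2 *\<^sub>R (N *v y)) - 2 *\<^sub>R (N *v e) - (x \<bullet> x) *\<^sub>R e))
    \<le> - c * Y\<^sup>2 + 4 / c * ((2 * n * E)\<^sup>2 + (Y * (X * E))\<^sup>2 + (r * X * E)\<^sup>2)" .
  have "(2 * n * E)\<^sup>2 + (Y * (X * E))\<^sup>2 + (r * X * E)\<^sup>2
      \<le> (4 * n\<^sup>2 + 1 + r\<^sup>2) * ((1 + X\<^sup>2) * E\<^sup>2) * (Y\<^sup>2 + 1)"
  proof -
    have "(4 * n\<^sup>2 + 1 + r\<^sup>2) * ((1 + X\<^sup>2) * E\<^sup>2) * (Y\<^sup>2 + 1) - ((2 * n * E)\<^sup>2 + (Y * (X * E))\<^sup>2 + (r * X * E)\<^sup>2)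
      = 4 * n\<^sup>2 * E\<^sup>2 * (Y\<^sup>2 + X\<^sup>2 * (Y\<^sup>2 + 1)) + E\<^sup>2 * (Y\<^sup>2 + 1 + X\<^sup>2) + r\<^sup>2 * E\<^sup>2 * (Y\<^sup>2 + 1 + X\<^sup>2 * Y\<^sup>2)"
      by (simp add: algebra_simps power_mult_distrib)
    moreover have "\<dots> \<ge> 0" by simp
    ultimately show ?thesis by linarith
  qed
  then have "4 / c * ((2 * n * E)\<^sup>2 + (Y * (X * E))\<^sup>2 + (r * X * E)\<^sup>2)
      \<le> 4 / c * ((4 * n\<^sup>2 + 1 + r\<^sup>2) * ((1 + X\<^sup>2) * E\<^sup>2) * (Y\<^sup>2 + 1))"
    by (rule mult_left_mono) (use c in simp)
  also have "\<dots> = gain v * ((1 + X\<^sup>2) * E\<^sup>2) * (Y\<^sup>2 + 1)"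
    unfolding gain by (simp only: mult.assoc)
  finally show ?thesis using upper unfolding sq by linarith
qed

lemma lyap_derivative:
  assumes sol: "solution_on S x z w K" and t: "t \<in> S" and v: "V (x t) (z t) (w t) (K t) \<le> v"
  defines "e \<equiv> err (x t) (z t) (w t)"
  shows "\<exists>d. ((\<lambda>t. lyap (gain v) (x t) (z t) (w t) (K t)) has_real_derivative d) (at t within S)
    \<and> d \<le> - c * W (x t) (z t) (w t) - e \<bullet> e"
proof -
  define y where "y = dev (x t) (z t) (w t)"
  define k where "k = gain v"
  define y' where "y' = - (y - 2 *\<^sub>R (N *v y)) - 2 *\<^sub>R (N *v e) - (x t \<bullet> x t) *\<^sub>R e"
  define V' where "V' = - ((1 + x t \<bullet> x t) * (e \<bullet> e))"
  define G where "G = exp (k * V (x t) (z t) (w t) (K t))"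
  note dV = V_derivative[OF sol t, folded e_def, folded V'_def]
  note dy = dev_derivative[OF sol t, folded e_def y_def, folded y'_def]
  have dW: "((\<lambda>t. W (x t) (z t) (w t)) has_real_derivative 2 * (y \<bullet> y')) (at t within S)"
    unfolding W_def using has_real_derivative_inner[OF dy dy]
    by (simp add: y_def[symmetric] inner_commute)
  have "((\<lambda>t. lyap k (x t) (z t) (w t) (K t)) has_real_derivative
      (2 * (y \<bullet> y') + (y \<bullet> y + 1) * (k * V')) * G + V') (at t within S)"
    unfolding lyap_def
    by (rule derivative_eq_intros dW dV refl)+
      (simp add: W_def y_def[symmetric] G_def[symmetric] algebra_simps)
  moreover have "(2 * (y \<bullet> y') + (y \<bullet> y + 1) * (k * V')) * G + V' \<le> - c * (y \<bullet> y) - e \<bullet> e"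
  proof -
    have ne: "norm e \<le> sqrt (2 * v)" using norm_err_le[OF v] by (simp add: e_def)
    have y: "x t + e - xo = y" by (simp add: y_def dev_def e_def)
    have "2 * (y \<bullet> y') \<le> - c * (y \<bullet> y) + k * (- V') * (y \<bullet> y + 1)"
      using dev_dissipation[OF ne, of "x t"] unfolding y by (simp add: y'_def V'_def k_def)
    then have le: "2 * (y \<bullet> y') + (y \<bullet> y + 1) * (k * V') \<le> - c * (y \<bullet> y)"
      by (simp add: algebra_simps)
    have "k \<ge> 0" using c by (simp add: k_def gain_def)
    then have G: "G \<ge> 1" using V_nonneg by (simp add: G_def)
    have "(2 * (y \<bullet> y') + (y \<bullet> y + 1) * (k * V')) * G \<le> - c * (y \<bullet> y) * G"
      using le G by (intro mult_right_mono) auto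
    also have "\<dots> \<le> - c * (y \<bullet> y)"
      using G c mult_left_mono[of 1 G "c * (y \<bullet> y)"] by simp
    finally have "(2 * (y \<bullet> y') + (y \<bullet> y + 1) * (k * V')) * G \<le> - c * (y \<bullet> y)" .
    moreover have "V' \<le> - (e \<bullet> e)" by (simp add: V'_def algebra_simps)
    ultimately show ?thesis by simp
  qed
  ultimately show ?thesis by (auto simp: k_def W_def y_def)
qed

lemma V_le_initial:
  assumes "solution_on {0..T} x z w K" "T \<ge> 0"
  shows "V (x T) (z T) (w T) (K T) \<le> V (x 0) (z 0) (w 0) (K 0)"
  by (rule antitone_of_nonpos_derivative_on_Icc[OF assms(2) V_derivative[OF assms(1)]]) auto

lemma lyap_le_initial:
  assumes sol: "solution_on {0..T} x z w K" and T: "T \<ge> 0"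
  defines "k \<equiv> gain (V (x 0) (z 0) (w 0) (K 0))"
  shows "lyap k (x T) (z T) (w T) (K T) \<le> lyap k (x 0) (z 0) (w 0) (K 0)"
proof -
  have "\<forall>t\<in>{0..T}. \<exists>d. ((\<lambda>t. lyap k (x t) (z t) (w t) (K t)) has_real_derivative d) (at t within {0..T})
      \<and> d \<le> 0"
  proof
    fix t assume t: "t \<in> {0..T}"
    \<comment> \<open>Since \<open>V\<close> never exceeds its initial value, the gain fixed at time
      zero is valid on the whole interval.\<close>
    have "V (x t) (z t) (w t) (K t) \<le> V (x 0) (z 0) (w 0) (K 0)"
      using t by (intro V_le_initial solution_on_subset[OF sol]) auto
    from lyap_derivative[OF sol t this]
    obtain d where d: "((\<lambda>t. lyap k (x t) (z t) (w t) (K t)) has_real_derivative d) (at t within {0..T})"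
      "d \<le> - c * W (x t) (z t) (w t) - err (x t) (z t) (w t) \<bullet> err (x t) (z t) (w t)"
      unfolding k_def by auto
    have "0 \<le> c * W (x t) (z t) (w t) + err (x t) (z t) (w t) \<bullet> err (x t) (z t) (w t)"
      using c W_nonneg by simp
    then have "d \<le> 0" using d(2) by linarith
    then show "\<exists>d. ((\<lambda>t. lyap k (x t) (z t) (w t) (K t)) has_real_derivative d) (at t within {0..T}) \<and> d \<le> 0"
      using d(1) by blast
  qed
  from bchoice[OF this] obtain d where
    "\<forall>t\<in>{0..T}. ((\<lambda>t. lyap k (x t) (z t) (w t) (K t)) has_real_derivative d t) (at t within {0..T}) \<and> d t \<le> 0"
    by auto
  then show ?thesis by (intro antitone_of_nonpos_derivative_on_Icc[OF T, where f' = d]) auto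
qed

section \<open>A priori bounds\<close>

text \<open>The Lyapunov function dominates \<open>W\<close>, and \<open>V\<close> controls the
  error and \<open>K - N\<close>. The bounds depend on the initial data but not on \<open>T\<close>,
  as continuation and Barbalat's argument require.\<close>

lemma apriori_bound_xK:
  fixes x0 z0 w0 :: "real^'n" and K0 :: "real^'n^'n"
  obtains X \<kappa> where "X \<ge> 0" "\<kappa> \<ge> 0"
    "\<And>T x z w K. \<lbrakk>solution_on {0..T} x z w K; T \<ge> 0; x 0 = x0; z 0 = z0; w 0 = w0; K 0 = K0\<rbrakk>
      \<Longrightarrow> norm (x T) \<le> X \<and> norm (K T) \<le> \<kappa>"
proof
  define v where "v = V x0 z0 w0 K0"
  define l where "l = lyap (gain v) x0 z0 w0 K0"
  have v0: "v \<ge> 0" by (simp add: v_def V_nonneg)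
  have g0: "gain v \<ge> 0" using c by (simp add: gain_def)
  have l0: "l \<ge> 0" by (simp add: l_def lyap_def V_nonneg W_nonneg)
  show "sqrt l + sqrt (2 * v) + norm xo \<ge> 0" "sqrt (2 * v) + norm N \<ge> 0" using v0 l0 by simp_all
  fix T x z w K
  assume sol: "solution_on {0..T} x z w K" and T: "T \<ge> 0"
    and init: "x 0 = x0" "z 0 = z0" "w 0 = w0" "K 0 = K0"
  have V: "V (x T) (z T) (w T) (K T) \<le> v" using V_le_initial[OF sol T] by (simp add: init v_def)
  have "W (x T) (z T) (w T) + 1 \<le> (W (x T) (z T) (w T) + 1) * exp (gain v * V (x T) (z T) (w T) (K T))"
    using mult_left_mono[of 1 "exp (gain v * V (x T) (z T) (w T) (K T))" "W (x T) (z T) (w T) + 1"]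
      W_nonneg g0 V_nonneg by simp
  also have "\<dots> \<le> l"
    using lyap_le_initial[OF sol T] V_nonneg[of "x T" "z T" "w T" "K T"]
    by (simp add: init l_def v_def lyap_def)
  finally have "W (x T) (z T) (w T) \<le> l" by simp
  then have dev: "norm (dev (x T) (z T) (w T)) \<le> sqrt l"
    unfolding W_def norm_eq_sqrt_inner by simp
  have "x T = dev (x T) (z T) (w T) - err (x T) (z T) (w T) + xo" by (simp add: dev_def)
  then have "norm (x T) \<le> norm (dev (x T) (z T) (w T)) + norm (err (x T) (z T) (w T)) + norm xo"
    using norm_diff_add_le[of "dev (x T) (z T) (w T)" "err (x T) (z T) (w T)" xo] by simp
  moreover have "norm (K T) \<le> norm (K T - N) + norm N"
    by (metis diff_add_cancel norm_triangle_ineq)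
  ultimately show "norm (x T) \<le> sqrt l + sqrt (2 * v) + norm xo \<and> norm (K T) \<le> sqrt (2 * v) + norm N"
    using dev norm_err_le[OF V] norm_gap_le[OF V] by auto
qed

text \<open>Once \<open>x\<close> and \<open>K\<close> are bounded, \<open>z\<close> is the output
  of a stable linear filter with bounded input, and \<open>w\<close> is recovered algebraically as
  \<open>x - z\<close> minus the error.\<close>

lemma apriori_bound:
  fixes x0 z0 w0 :: "real^'n" and K0 :: "real^'n^'n"
  obtains R where
    "\<And>T x z w K. \<lbrakk>solution_on {0..T} x z w K; T \<ge> 0; x 0 = x0; z 0 = z0; w 0 = w0; K 0 = K0\<rbrakk>
      \<Longrightarrow> norm (x T, z T, w T, K T) \<le> R"
proof -
  obtain X \<kappa> where X: "X \<ge> 0" "\<kappa> \<ge> 0" and xK: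
    "\<And>T x z w K. \<lbrakk>solution_on {0..T} x z w K; T \<ge> 0; x 0 = x0; z 0 = z0; w 0 = w0; K 0 = K0\<rbrakk>
      \<Longrightarrow> norm (x T) \<le> X \<and> norm (K T) \<le> \<kappa>"
    by (rule apriori_bound_xK[of x0 z0 w0 K0]) (rule that; blast)
  define v where "v = V x0 z0 w0 K0"
  define g where "g = 2 * (\<kappa> * X) + norm b"
  have g: "g \<ge> 0" using X by (simp add: g_def)
  define Z where "Z = sqrt (z0 \<bullet> z0 + g\<^sup>2)"
  show ?thesis
  proof (rule that[of "X + (Z + ((X + Z + sqrt (2 * v)) + \<kappa>))"])
    fix T x z w K
    assume sol: "solution_on {0..T} x z w K" and T: "T \<ge> 0"
      and init: "x 0 = x0" "z 0 = z0" "w 0 = w0" "K 0 = K0"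
    have bd: "norm (2 *\<^sub>R (K t *v x t) + b) \<le> g" if "t \<in> {0..T}" for t
    proof -
      have "solution_on {0..t} x z w K" using that by (intro solution_on_subset[OF sol]) auto
      then have "norm (x t) \<le> X" "norm (K t) \<le> \<kappa>" using xK[of t x z w K] that init by auto
      then have "norm (K t *v x t) \<le> \<kappa> * X"
        using norm_matrix_vector_mult_le[of "K t" "x t"] mult_mono[of "norm (K t)" \<kappa> "norm (x t)" X] X by auto
      then show ?thesis using norm_triangle_ineq[of "2 *\<^sub>R (K t *v x t)" b] by (simp add: g_def)
    qed
    \<comment> \<open>Young's inequality gives
      \<open>(|z|\<^sup>2)' \<le> g\<^sup>2 - |z|\<^sup>2\<close>; the factor \<open>exp t\<close>
      integrates this.\<close>
    have "(z T \<bullet> z T - g\<^sup>2) * exp T \<le> (z 0 \<bullet> z 0 - g\<^sup>2) * exp 0"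
    proof (rule antitone_of_nonpos_derivative_on_Icc[OF T])
      fix t assume t: "t \<in> {0..T}"
      define q where "q = 2 *\<^sub>R (K t *v x t) + b"
      have "(z has_vector_derivative q - z t) (at t within {0..T})"
        using sol t by (auto simp: solution_on_def q_def)
      note dz = has_real_derivative_inner[OF this this]
      show "((\<lambda>t. (z t \<bullet> z t - g\<^sup>2) * exp t) has_real_derivative
          (2 * (z t \<bullet> q) - z t \<bullet> z t - g\<^sup>2) * exp t) (at t within {0..T})"
        by (rule derivative_eq_intros dz refl)+ (simp add: inner_diff_right inner_diff_left inner_commute algebra_simps)
      have "2 * (z t \<bullet> q) \<le> z t \<bullet> z t + q \<bullet> q"
        using inner_ge_zero[of "z t - q"] by (simp add: inner_diff_right inner_diff_left inner_commute)
      moreover have "q \<bullet> q \<le> g\<^sup>2"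
        using bd[OF t] power_mono[of "norm q" g 2] by (simp add: q_def power2_norm_eq_inner)
      ultimately show "(2 * (z t \<bullet> q) - z t \<bullet> z t - g\<^sup>2) * exp t \<le> 0"
        by (intro mult_nonpos_nonneg) auto
    qed
    then have "(z T \<bullet> z T - g\<^sup>2) * exp T \<le> z0 \<bullet> z0" using g by (simp add: init) (smt (verit) zero_le_power2)
    then have "z T \<bullet> z T \<le> z0 \<bullet> z0 + g\<^sup>2"
    proof -
      assume *: "(z T \<bullet> z T - g\<^sup>2) * exp T \<le> z0 \<bullet> z0"
      \<comment> \<open>The factor \<open>exp T \<ge> 1\<close> may be dropped only when the
        difference it multiplies is nonnegative.\<close>
      show ?thesis
      proof (cases "z T \<bullet> z T \<le> g\<^sup>2")
        case False
        then have "(z T \<bullet> z T - g\<^sup>2) * 1 \<le> (z T \<bullet> z T - g\<^sup>2) * exp T"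
          using T by (intro mult_left_mono) auto
        then show ?thesis using * by simp
      qed (use inner_ge_zero[of z0] in linarith)
    qed
    then have z: "norm (z T) \<le> Z" by (simp add: Z_def norm_eq_sqrt_inner)
    have x: "norm (x T) \<le> X" "norm (K T) \<le> \<kappa>" using xK[OF sol T init] by auto
    have "norm (err (x T) (z T) (w T)) \<le> sqrt (2 * v)"
      using V_le_initial[OF sol T] by (intro norm_err_le) (simp add: init v_def)
    moreover have "w T = x T - z T - err (x T) (z T) (w T)" by (simp add: err_def)
    then have "norm (w T) \<le> norm (x T) + norm (z T) + norm (err (x T) (z T) (w T))"
      using norm_triangle_ineq4[of "x T - z T" "err (x T) (z T) (w T)"] norm_triangle_ineq4[of "x T" "z T"]
      by simp
    ultimately have w: "norm (w T) \<le> X + Z + sqrt (2 * v)" using x z by linarith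
    have "norm (x T, z T, w T, K T) \<le> norm (x T) + (norm (z T) + (norm (w T) + norm (K T)))"
      by (intro order_trans[OF norm_Pair_le] add_left_mono order_refl)
    then show "norm (x T, z T, w T, K T) \<le> X + (Z + ((X + Z + sqrt (2 * v)) + \<kappa>))"
      using x z w by linarith
  qed
qed

section \<open>Global existence\<close>

text \<open>The loop as an autonomous field on the product space. Projections are written out so
  that each component is visibly a sum of bilinear expressions in bounded linear maps, which is how
  \<open>lipschitz_field\<close> treats it.\<close>

definition field :: "(real^'n) \<times> (real^'n) \<times> (real^'n) \<times> (real^'n^'n) \<Rightarrow> (real^'n) \<times> (real^'n) \<times> (real^'n) \<times> (real^'n^'n)"
where "field = (\<lambda>s. (N *v fst s - fst s + b + snd (snd (snd s)) *v fst s,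
   2 *\<^sub>R (snd (snd (snd s)) *v fst s) + b - fst (snd s),
   (fst s \<bullet> fst s) *\<^sub>R (fst s - fst (snd s) - fst (snd (snd s))) - fst (snd (snd s)),
   outer_product (fst s - fst (snd s) - fst (snd (snd s))) (fst s)))"

lemma lipschitz_field: "\<exists>L. L-lipschitz_on (cball 0 r) field"
proof -
  let ?S = "cball (0 :: (real^'n) \<times> (real^'n) \<times> (real^'n) \<times> (real^'n^'n)) r"
  have linear: "\<exists>L. L-lipschitz_on ?S f" if "bounded_linear f"
    for f :: "_ \<Rightarrow> 'b::real_normed_vector"
    using bounded_linear.lipschitz_boundE[OF that] by metis
  have add: "\<exists>L. L-lipschitz_on ?S (\<lambda>s. f s + g s)"
    if "\<exists>L. L-lipschitz_on ?S f" "\<exists>L. L-lipschitz_on ?S g" for f g :: "_ \<Rightarrow> real^'n"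
    using that lipschitz_on_add by blast
  have diff: "\<exists>L. L-lipschitz_on ?S (\<lambda>s. f s - g s)"
    if "\<exists>L. L-lipschitz_on ?S f" "\<exists>L. L-lipschitz_on ?S g" for f g :: "_ \<Rightarrow> real^'n"
    using that lipschitz_on_diff by blast
  have pair: "\<exists>L. L-lipschitz_on ?S (\<lambda>s. (f s, g s))"
    if "\<exists>L. L-lipschitz_on ?S f" "\<exists>L. L-lipschitz_on ?S g"
    for f :: "_ \<Rightarrow> 'b::metric_space" and g :: "_ \<Rightarrow> 'c::metric_space"
    using that lipschitz_on_Pair by blast
  have const: "\<exists>L. L-lipschitz_on ?S (\<lambda>_. d)" for d :: "'b::metric_space" using lipschitz_on_constant by blast
  note mult = lipschitz_on_bounded_bilinear[OF _ compact_cball]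
  have lins: "bounded_linear fst" "bounded_linear (\<lambda>s. fst (snd s))"
     "bounded_linear (\<lambda>s. fst (snd (snd s)))" "bounded_linear (\<lambda>s. snd (snd (snd s)))"
    by (intro bounded_linear_intros)+
  show ?thesis
    unfolding field_def
    by (intro pair add diff mult[OF bounded_bilinear_matrix_vector_mult]
        mult[OF bounded_bilinear_inner] mult[OF bounded_bilinear_scaleR]
        mult[OF bounded_bilinear_outer_product] const linear lins)
qed

lemma solution_on_of_field:
  assumes s: "\<And>t. t \<in> S \<Longrightarrow> (s has_vector_derivative field (s t)) (at t within S)"
  shows "solution_on S (\<lambda>t. fst (s t)) (\<lambda>t. fst (snd (s t))) (\<lambda>t. fst (snd (snd (s t))))
    (\<lambda>t. snd (snd (snd (s t))))"
  unfolding solution_on_def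
proof (intro ballI conjI)
  fix t assume t: "t \<in> S"
  note proj = bounded_linear.has_vector_derivative[OF _ s[OF t]]
  show "((\<lambda>t. fst (s t)) has_vector_derivative
      N *v fst (s t) - fst (s t) + b + snd (snd (snd (s t))) *v fst (s t)) (at t within S)"
    using proj[of fst] by (simp add: field_def bounded_linear_fst)
  show "((\<lambda>t. fst (snd (s t))) has_vector_derivative
      2 *\<^sub>R (snd (snd (snd (s t))) *v fst (s t)) + b - fst (snd (s t))) (at t within S)"
    using proj[of "\<lambda>s. fst (snd s)"] by (simp add: field_def bounded_linear_intros)
  show "((\<lambda>t. fst (snd (snd (s t)))) has_vector_derivative
      (fst (s t) \<bullet> fst (s t)) *\<^sub>R (fst (s t) - fst (snd (s t)) - fst (snd (snd (s t))))
        - fst (snd (snd (s t)))) (at t within S)"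
    using proj[of "\<lambda>s. fst (snd (snd s))"] by (simp add: field_def bounded_linear_intros)
  show "((\<lambda>t. snd (snd (snd (s t)))) has_vector_derivative
      outer_product (fst (s t) - fst (snd (s t)) - fst (snd (snd (s t)))) (fst (s t))) (at t within S)"
    using proj[of "\<lambda>s. snd (snd (snd s))"] by (simp add: field_def bounded_linear_intros)
qed

lemma global_existence:
  fixes x0 z0 w0 :: "real^'n" and K0 :: "real^'n^'n"
  shows "\<exists>x z w K. solution_on {0..} x z w K \<and> x 0 = x0 \<and> z 0 = z0 \<and> w 0 = w0 \<and> K 0 = K0"
proof -
  obtain R where R: "\<And>T x z w K. \<lbrakk>solution_on {0..T} x z w K; T \<ge> 0; x 0 = x0; z 0 = z0; w 0 = w0; K 0 = K0\<rbrakk>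
      \<Longrightarrow> norm (x T, z T, w T, K T) \<le> R"
    by (rule apriori_bound[of x0 z0 w0 K0]) (rule that; blast)
  have "\<exists>s. s 0 = (x0, z0, w0, K0) \<and> (\<forall>t\<ge>0. (s has_vector_derivative field (s t)) (at t within {0..}))"
  proof (rule global_solution_of_apriori_bound[OF lipschitz_field])
    fix T :: real and s
    assume T: "T \<ge> 0" and s0: "s 0 = (x0, z0, w0, K0)"
      and s: "\<And>t. t \<in> {0..T} \<Longrightarrow> (s has_vector_derivative field (s t)) (at t within {0..T})"
    show "norm (s T) \<le> R"
      using R[OF solution_on_of_field[OF s] T] s0 by simp
  qed
  then obtain s where s0: "s 0 = (x0, z0, w0, K0)"
    and s: "\<And>t. t \<ge> 0 \<Longrightarrow> (s has_vector_derivative field (s t)) (at t within {0..})" by blast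
  show ?thesis
  proof (intro exI conjI)
    show "solution_on {0..} (\<lambda>t. fst (s t)) (\<lambda>t. fst (snd (s t))) (\<lambda>t. fst (snd (snd (s t))))
      (\<lambda>t. snd (snd (snd (s t))))"
      by (rule solution_on_of_field) (use s in auto)
  qed (simp_all add: s0)
qed

section \<open>Convergence of the action profile\<close>

text \<open>Barbalat's argument is applied directly to a multiple of
  \<open>|x - xo|\<^sup>2\<close>, whose derivative is bounded because \<open>x\<close> and
  \<open>K\<close> are.\<close>

lemma actions_converge:
  assumes sol: "solution_on {0..} x z w K"
  shows "(x \<longlongrightarrow> xo) at_top"
proof -
  define v where "v = V (x 0) (z 0) (w 0) (K 0)"
  \<comment> \<open>As \<open>x - xo\<close> is the deviation minus the error, its square is at most
    twice the sum of their squares; this \<open>\<kappa>\<close> fits that under the decay rates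
    \<open>c\<close> and \<open>1\<close>.\<close>
  define \<kappa> where "\<kappa> = min c 1 / 2"
  have \<kappa>: "\<kappa> > 0" "2 * \<kappa> \<le> c" "2 * \<kappa> \<le> 1" using c by (auto simp: \<kappa>_def)
  define D where "D t = x t - xo" for t
  have before: "solution_on {0..t} x z w K" for t by (rule solution_on_subset[OF sol]) auto
  have "\<forall>t\<in>{0..}. \<exists>d. ((\<lambda>t. lyap (gain v) (x t) (z t) (w t) (K t)) has_real_derivative d) (at t within {0..})
    \<and> d \<le> - c * W (x t) (z t) (w t) - err (x t) (z t) (w t) \<bullet> err (x t) (z t) (w t)"
    using V_le_initial[OF before] by (intro ballI lyap_derivative[OF sol]) (auto simp: v_def)
  from bchoice[OF this] obtain d where
    d: "\<And>t. t \<ge> 0 \<Longrightarrow> ((\<lambda>t. lyap (gain v) (x t) (z t) (w t) (K t)) has_real_derivative d t) (at t within {0..})"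
    and d_le: "\<And>t. t \<ge> 0 \<Longrightarrow> d t \<le> - c * W (x t) (z t) (w t) - err (x t) (z t) (w t) \<bullet> err (x t) (z t) (w t)"
    by auto
  obtain X k where X: "X \<ge> 0" "k \<ge> 0" and bd': "\<And>T x' z' w' K'. \<lbrakk>solution_on {0..T} x' z' w' K'; T \<ge> 0;
      x' 0 = x 0; z' 0 = z 0; w' 0 = w 0; K' 0 = K 0\<rbrakk> \<Longrightarrow> norm (x' T) \<le> X \<and> norm (K' T) \<le> k"
    by (rule apriori_bound_xK[of "x 0" "z 0" "w 0" "K 0"]) (rule that; blast)
  have bd: "norm (x t) \<le> X" "norm (K t) \<le> k" if "t \<ge> 0" for t using bd'[OF before that] by auto
  define x' where "x' t = N *v x t - x t + b + K t *v x t" for t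
  have dx: "(D has_vector_derivative x' t) (at t within {0..})" if "t \<ge> 0" for t
    using sol that unfolding D_def x'_def solution_on_def
    by (auto intro!: derivative_eq_intros)
  define M where "M = norm N * X + X + norm b + k * X"
  have x': "norm (x' t) \<le> M" if "t \<ge> 0" for t
  proof -
    have "norm (N *v x t) \<le> norm N * X"
      using norm_matrix_vector_mult_le[of N "x t"] mult_left_mono[OF bd(1)[OF that], of "norm N"] by simp
    moreover have "norm (K t *v x t) \<le> k * X"
      using norm_matrix_vector_mult_le[of "K t" "x t"]
        mult_mono[OF bd(2)[OF that] bd(1)[OF that] X(2) norm_ge_zero] by simp
    moreover have "norm (x' t) \<le> norm (N *v x t) + norm (x t) + norm b + norm (K t *v x t)"
      unfolding x'_def
      using norm_triangle_ineq[of "N *v x t - x t + b" "K t *v x t"] norm_diff_add_le[of "N *v x t" "x t" b]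
      by simp
    ultimately show ?thesis using bd(1)[OF that] unfolding M_def by linarith
  qed
  have D: "norm (D t) \<le> X + norm xo" if "t \<ge> 0" for t
    using norm_triangle_ineq4[of "x t" xo] bd(1)[OF that] by (simp add: D_def)
  \<comment> \<open>Cauchy-Schwarz bounds the derivative of \<open>D t \<bullet> D t\<close> by the
    first summand; the \<open>1\<close> makes \<open>C\<close> strictly positive.\<close>
  define C where "C = 2 * ((X + norm xo) * M) + 1"
  have M: "M \<ge> 0" using X by (simp add: M_def)
  have "(X + norm xo) * M \<ge> 0" using X M by simp
  then have C: "C > 0" by (simp add: C_def)
  have "((\<lambda>t. \<kappa> * (D t \<bullet> D t)) \<longlongrightarrow> 0) at_top"
  proof (rule tendsto_zero_of_dissipation[OF d _ _ _ _ _ C])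
    fix t :: real assume t: "t \<ge> 0"
    define y where "y = dev (x t) (z t) (w t)"
    define e where "e = err (x t) (z t) (w t)"
    have "D t = y - e" by (simp add: D_def y_def dev_def e_def)
    then have "D t \<bullet> D t \<le> 2 * (y \<bullet> y) + 2 * (e \<bullet> e)"
      using inner_ge_zero[of "y + e"]
      by (simp add: inner_diff_left inner_diff_right inner_add_left inner_add_right inner_commute)
    then have "\<kappa> * (D t \<bullet> D t) \<le> \<kappa> * (2 * (y \<bullet> y) + 2 * (e \<bullet> e))"
      using \<kappa> by (intro mult_left_mono) auto
    also have "\<dots> = (2 * \<kappa>) * (y \<bullet> y) + (2 * \<kappa>) * (e \<bullet> e)" by (simp add: algebra_simps)
    also have "\<dots> \<le> c * (y \<bullet> y) + 1 * (e \<bullet> e)"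
      using \<kappa> by (intro add_mono mult_right_mono) auto
    finally show "d t \<le> - (\<kappa> * (D t \<bullet> D t))"
      using d_le[OF t] by (simp add: W_def y_def e_def)
    show "0 \<le> lyap (gain v) (x t) (z t) (w t) (K t)" by (simp add: lyap_def V_nonneg W_nonneg)
    show "0 \<le> \<kappa> * (D t \<bullet> D t)" using \<kappa> by simp
    show "((\<lambda>t. \<kappa> * (D t \<bullet> D t)) has_real_derivative \<kappa> * (2 * (D t \<bullet> x' t))) (at t within {0..})"
      using DERIV_cmult[OF has_real_derivative_inner[OF dx[OF t] dx[OF t]], of \<kappa>]
      by (simp add: inner_commute)
    have "\<bar>D t \<bullet> x' t\<bar> \<le> (X + norm xo) * M"
      using Cauchy_Schwarz_ineq2[of "D t" "x' t"] mult_mono[OF D[OF t] x'[OF t]] X by simp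
    then have "\<bar>2 * (D t \<bullet> x' t)\<bar> \<le> C" by (simp add: C_def)
    moreover have "\<bar>\<kappa> * (2 * (D t \<bullet> x' t))\<bar> \<le> 1 * \<bar>2 * (D t \<bullet> x' t)\<bar>"
      unfolding abs_mult[of \<kappa>] using \<kappa> by (intro mult_right_mono) auto
    ultimately show "- C \<le> \<kappa> * (2 * (D t \<bullet> x' t))" by linarith
  qed auto
  from tendsto_mult[OF tendsto_const[of "1 / \<kappa>"] this]
  have "((\<lambda>t. D t \<bullet> D t) \<longlongrightarrow> 0) at_top" using \<kappa> by simp
  from tendsto_real_sqrt[OF this] have "((\<lambda>t. norm (D t)) \<longlongrightarrow> 0) at_top"
    by (simp add: norm_eq_sqrt_inner)
  then have "(D \<longlongrightarrow> 0) at_top" by (rule tendsto_norm_zero_cancel)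
  then show ?thesis unfolding D_def by (rule LIM_zero_cancel)
qed

end

section \<open>Transfer from the coercive game to the closed loop\<close>

theorem mainTheorem5:
  fixes P :: "real^'n^'n" and a :: real and b :: "real^'n"
    and x0 z0 w0 :: "real^'n" and K0 :: "real^'n^'n"
  assumes "P = transpose P"
    and "\<And>i j. P$i$j \<in> {0..1}"
    and "\<And>i. P$i$i = 0"
    and "a \<noteq> 0"
    and "Max ((\<lambda>l. a * l) ` spectrum (P + transpose P)) < 1"
  shows "(\<exists>x z w K. closed_loop_solution P a b x z w K \<and>
            x 0 = x0 \<and> z 0 = z0 \<and> w 0 = w0 \<and> K 0 = K0) \<and>
         (\<forall>x z w K. closed_loop_solution P a b x z w K \<and>
            x 0 = x0 \<and> z 0 = z0 \<and> w 0 = w0 \<and> K 0 = K0 \<longrightarrow>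
            (x \<longlongrightarrow> social_optimum P a b) at_top)"
proof -
  have sym: "transpose P = P" using assms(1) by simp
  have "transpose (P + transpose P) = P + transpose P"
    by (simp add: transpose_def vec_eq_iff)
  from coercive_of_spectrum_bound[OF this assms(4,5)]
  obtain c where c: "c > 0" "\<And>v. c * (v \<bullet> v) \<le> v \<bullet> (v - a *\<^sub>R ((P + transpose P) *v v))" by blast
  \<comment> \<open>Symmetry turns \<open>P + transpose P\<close> into \<open>2P\<close>, so the
    spectral condition is coercivity of \<open>I - 2N\<close> with \<open>N = aP\<close>.\<close>
  have double: "a *\<^sub>R ((P + transpose P) *v v) = (2 * a) *\<^sub>R (P *v v)" for v
    by (simp add: sym scaleR_2[symmetric] scaleR_matrix_vector_assoc[symmetric] mult.commute)
  have coer: "c * (v \<bullet> v) \<le> v \<bullet> (v - (2 * a) *\<^sub>R (P *v v))" for v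
    using c(2)[of v] by (simp add: double)
  have scale: "2 *\<^sub>R ((a *\<^sub>R P) *v v) = (2 * a) *\<^sub>R (P *v v)" for v
    by (simp add: scaleR_matrix_vector_assoc[symmetric])
  interpret coercive_game "a *\<^sub>R P" b "social_optimum P a b" c
    by unfold_locales (use c(1) coer social_optimum_solves[OF sym c(1) coer, of b] in \<open>simp_all add: scale\<close>)
  have x_eq: "(- mat 1 + a *\<^sub>R P) *v x + b + u = (a *\<^sub>R P) *v x - x + b + u" for x u
    using matrix_vector_mult_diff_rdistrib[of "a *\<^sub>R P" "mat 1" x] by simp
  have z_eq: "- z + u + b + u = 2 *\<^sub>R u + b - z" for z u :: "real^'n"
    by (simp add: scaleR_2)
  have w_eq: "- w + q *\<^sub>R e = q *\<^sub>R e - w" for w e :: "real^'n" and q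
    by simp
  have "closed_loop_solution P a b x z w K \<longleftrightarrow> solution_on {0..} x z w K" for x z w K
    unfolding closed_loop_solution_def solution_on_def Let_def x_eq z_eq w_eq by auto
  then show ?thesis using global_existence[of x0 z0 w0 K0] actions_converge by auto
qed

end
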